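(* Fix $\lambda>0$, $t\in\mathbb{R}$, $T>0$ and $\gamma\in[0,1]$. For $\sigma>0$ let $q^{(\sigma)}_n$ and $q^{(\sigma)}_{\gamma,n}$ ($n\ge 0$) be the probabilities that exactly $n$ arrivals occur in $(t,t+T]$ for the pre-scheduled random arrivals process without deletions and with independent deletions of probability $1-\gamma$, respectively, with generating functions $q^{(\sigma)}(z)=\sum_{n\ge0}q^{(\sigma)}_nz^n$ and $q^{(\sigma)}_\gamma(z)=\sum_{n\ge0}q^{(\sigma)}_{\gamma,n}z^n$. Let $q_n=e^{-\lambda T}(\lambda T)^n/n!$ and $q_{\gamma,n}=e^{-\gamma\lambda T}(\gamma\lambda T)^n/n!$ be the Poisson probabilities with parameters $\lambda T$ and $\gamma\lambda T$, with generating functions $q(z)=\exp(\lambda T(z-1))$ and $q_\gamma(z)=\exp(\gamma\lambda T(z-1))$. If $q^{(\sigma)}(z)\to q(z)$ as $\sigma\to\infty$ for all $|z|\le 1$, then $$\sum_{n=0}^{\infty}\bigl|q^{(\sigma)}_n-q_n\bigr|\longrightarrow 0\qquad\text{as }\sigma\to\infty .$$ The same result holds for the arrivals with random deletions: if $q^{(\sigma)}_\gamma(z)\to q_\gamma(z)$ as $\sigma\to\infty$ for all $|z|\le 1$, then $\sum_{n=0}^{\infty}|q^{(\sigma)}_{\gamma,n}-q_{\gamma,n}|\to 0$ as $\sigma\to\infty$.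
   Context: Pre-scheduled random arrivals (PSRA) process: for $\lambda>0$, the arrival time of the $i$-th client is $t_i=\frac{i}{\lambda}+\xi_i$, $i\in\mathbb{Z}$, where the $\xi_i$ are i.i.d. real random variables with mean $0$, variance $\sigma^2$ and continuous probability density $f^{(\sigma)}_\xi$. It is assumed that $f^{(\sigma)}_\xi(x)=\frac1\sigma f_\xi(x/\sigma)$, where $f_\xi$ is a fixed (independent of $\sigma$) continuous probability density with finite variance and finite maximum $M=\max_{x\in\mathbb{R}}f_\xi(x)$. The number of arrivals in $(t,t+T]$ is the number of $i\in\mathbb{Z}$ with $t_i\in(t,t+T]$. In the process with independent deletions, each arrival $i\in\mathbb{Z}$ is independently (of everything else) cancelled with probability $1-\gamma$ and kept with probability $\gamma$; only kept arrivals are counted. *)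

theory Defs
  imports "HOL-Probability.Probability"
begin

text \<open>The fixed base density. Attainment of the maximum is part of the hypothesis.\<close>

locale psra_density =
  fixes f :: "real \<Rightarrow> real"
  assumes continuous: "continuous_on UNIV f"
    and nonneg: "\<And>x. 0 \<le> f x"
    and total_mass: "has_bochner_integral lborel f 1"
    and finite_variance: "integrable lborel (\<lambda>x. x\<^sup>2 * f x)"
    and finite_max: "\<exists>x0. \<forall>x. f x \<le> f x0"

text \<open>The delays of a process with scale \<open>\<sigma>\<close>. The variance condition
  forces the base density \<open>f\<close> to have variance 1.\<close>

locale psra_delays = prob_space M for M :: "'a measure" +
  fixes f :: "real \<Rightarrow> real" and \<sigma> :: real and \<xi> :: "int \<Rightarrow> 'a \<Rightarrow> real"
  assumes delays_indep: "indep_vars (\<lambda>_. borel) \<xi> UNIV"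
    and delays_density: "\<And>i. distributed M lborel (\<xi> i) (\<lambda>x. ennreal (1 / \<sigma> * f (x / \<sigma>)))"
    and delays_mean: "\<And>i. expectation (\<xi> i) = 0"
    and delays_variance: "\<And>i. variance (\<xi> i) = \<sigma>\<^sup>2"

text \<open>Arrival \<open>i\<close> is kept when \<open>kept i\<close> holds. All delays and all marks together form one
  mutually independent family; the marks are encoded as 0/1-valued reals because
  \<open>indep_vars\<close> needs a common value type.\<close>

locale psra_deletions = psra_delays M f \<sigma> \<xi>
  for M :: "'a measure" and f :: "real \<Rightarrow> real" and \<sigma> :: real and \<xi> :: "int \<Rightarrow> 'a \<Rightarrow> real" +
  fixes \<gamma> :: real and kept :: "int \<Rightarrow> 'a \<Rightarrow> bool"
  assumes delays_kept_indep:
      "indep_vars (\<lambda>_. borel) (case_sum \<xi> (\<lambda>i \<omega>. of_bool (kept i \<omega>))) (UNIV :: (int + int) set)"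
    and kept_prob: "\<And>i. prob {\<omega> \<in> space M. kept i \<omega>} = \<gamma>"

definition arrival_time :: "real \<Rightarrow> (int \<Rightarrow> 'a \<Rightarrow> real) \<Rightarrow> int \<Rightarrow> 'a \<Rightarrow> real" where
  "arrival_time lam \<xi> i \<omega> = of_int i / lam + \<xi> i \<omega>"

definition arrivals ::
  "real \<Rightarrow> (int \<Rightarrow> 'a \<Rightarrow> real) \<Rightarrow> real \<Rightarrow> real \<Rightarrow> 'a \<Rightarrow> int set" where
  "arrivals lam \<xi> t T \<omega> = {i. arrival_time lam \<xi> i \<omega> \<in> {t<..t + T}}"

definition kept_arrivals ::
  "real \<Rightarrow> (int \<Rightarrow> 'a \<Rightarrow> real) \<Rightarrow> (int \<Rightarrow> 'a \<Rightarrow> bool) \<Rightarrow> real \<Rightarrow> real \<Rightarrow> 'a \<Rightarrow> int set" where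
  "kept_arrivals lam \<xi> kept t T \<omega> = {i \<in> arrivals lam \<xi> t T \<omega>. kept i \<omega>}"

text \<open>Finiteness is required explicitly because \<open>card\<close> of an infinite set is 0.\<close>

definition count_prob :: "'a measure \<Rightarrow> ('a \<Rightarrow> int set) \<Rightarrow> nat \<Rightarrow> real" where
  "count_prob M A n = measure M {\<omega> \<in> space M. finite (A \<omega>) \<and> card (A \<omega>) = n}"

definition gen_fun :: "(nat \<Rightarrow> real) \<Rightarrow> complex \<Rightarrow> complex" where
  "gen_fun p z = (\<Sum>n. of_real (p n) * z ^ n)"

text \<open>Written out instead of using \<open>poisson_pmf\<close>, which needs a positive rate;
  here the rate 0 occurs.\<close>

definition poisson_prob :: "real \<Rightarrow> nat \<Rightarrow> real" where
  "poisson_prob r n = exp (- r) * r ^ n / fact n"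

end

theory Submission
  imports Defs
begin

text \<open>Convergence of the generating functions inside the unit disc forces convergence of each
  coefficient: near \<open>0\<close> a power series with uniformly bounded coefficients is dominated by its
  constant term. As the limit has total mass \<open>1\<close> and the approximating weights have mass at most
  \<open>1\<close>, the identity \<open>\<bar>x - y\<bar> = 2 * max 0 (y - x) + (x - y)\<close> bounds the \<open>\<ell>\<^sup>1\<close>-distance by a series
  dominated by the limit weights (Scheffe's argument).\<close>

lemma tendsto_constant_coeff:
  fixes a :: "'b \<Rightarrow> nat \<Rightarrow> complex"
  assumes bd: "\<forall>\<^sub>F s in F. \<forall>n. norm (a s n) \<le> B"
    and lim: "\<And>z. z \<noteq> 0 \<Longrightarrow> norm z < 1 \<Longrightarrow> ((\<lambda>s. \<Sum>n. a s n * z ^ n) \<longlongrightarrow> 0) F"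
  shows "((\<lambda>s. a s 0) \<longlongrightarrow> 0) F"
proof (rule tendstoI)
  fix e :: real
  assume e: "e > 0"
  \<comment> \<open>\<open>B\<close> may be zero or negative; enlarging it to at least 1 keeps the
    denominators below positive.\<close>
  define C where "C = max B 1"
  have C: "C > 0" "B \<le> C" by (auto simp: C_def)
  \<comment> \<open>The radius solves \<open>C * (r / (1 - r)) = e / 2\<close>: at the point
    \<open>r\<close>, all terms of index at least 1 together contribute at most
    \<open>e / 2\<close>, and the hypothesis at this single point leaves \<open>e / 2\<close> for
    the whole series.\<close>
  define r where "r = e / (e + 2 * C)"
  have r: "0 < r" "r < 1" using e C by (auto simp: r_def field_simps)
  have "1 - r = 2 * C / (e + 2 * C)" using e C by (simp add: r_def field_simps)
  then have tail: "C * (r / (1 - r)) = e / 2"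
    using e C by (simp add: r_def)
  have "\<forall>\<^sub>F s in F. norm (\<Sum>n. a s n * of_real r ^ n) < e / 2"
    using tendstoD[OF lim[of "of_real r"], of "e / 2"] r e by simp
  then show "\<forall>\<^sub>F s in F. dist (a s 0) 0 < e"
    using bd
  proof eventually_elim
    case (elim s)
    have le: "norm (a s n * of_real r ^ n) \<le> C * r ^ n" for n
      using order_trans[OF elim(2)[rule_format, of n] C(2)] r
      by (simp add: norm_mult norm_power mult_right_mono)
    have sg: "summable (\<lambda>n. C * r ^ n)" using r by (simp add: summable_mult)
    have sn: "summable (\<lambda>n. norm (a s n * of_real r ^ n))"
      by (rule summable_comparison_test'[OF sg, of 0]) (use le in simp)
    have "a s 0 = (\<Sum>n. a s n * of_real r ^ n) - (\<Sum>n. a s (Suc n) * of_real r ^ Suc n)"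
      using suminf_split_head[OF summable_norm_cancel[OF sn]] by simp
    also have "norm \<dots> \<le> norm (\<Sum>n. a s n * of_real r ^ n) + norm (\<Sum>n. a s (Suc n) * of_real r ^ Suc n)"
      by (rule norm_triangle_ineq4)
    also have "norm (\<Sum>n. a s (Suc n) * of_real r ^ Suc n) \<le> (\<Sum>n. C * r * r ^ n)"
    proof (rule norm_suminf_le)
      show "summable (\<lambda>n. C * r * r ^ n)" using r by (simp add: summable_mult)
      show "norm (a s (Suc n) * of_real r ^ Suc n) \<le> C * r * r ^ n" for n
        using le[of "Suc n"] by (simp add: mult.assoc)
    qed
    also have "\<dots> = e / 2"
      using r tail by (simp add: suminf_mult suminf_geometric divide_simps)
    finally show ?case using elim(1) by simp
  qed
qed

text \<open>Induction on \<open>k\<close> by a left shift of the coefficients: subtracting the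
  constant term, which already tends to 0, and dividing by \<open>z\<close> gives the shifted
  series. The quotient controls that series only for \<open>z \<noteq> 0\<close>, so the hypothesis
  leaves out the origin in order to be inherited by the shift.\<close>

lemma tendsto_coeff:
  fixes a :: "'b \<Rightarrow> nat \<Rightarrow> complex"
  assumes bd: "\<forall>\<^sub>F s in F. \<forall>n. norm (a s n) \<le> B"
    and lim: "\<And>z. z \<noteq> 0 \<Longrightarrow> norm z < 1 \<Longrightarrow> ((\<lambda>s. \<Sum>n. a s n * z ^ n) \<longlongrightarrow> 0) F"
  shows "((\<lambda>s. a s k) \<longlongrightarrow> 0) F"
  using assms
proof (induction k arbitrary: a)
  case 0
  show ?case by (rule tendsto_constant_coeff[OF 0])
next
  case (Suc k)
  have "((\<lambda>s. \<Sum>n. a s (Suc n) * z ^ n) \<longlongrightarrow> 0) F" if z: "z \<noteq> 0" "norm z < 1" for z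
  proof -
    have "((\<lambda>s. ((\<Sum>n. a s n * z ^ n) - a s 0) / z) \<longlongrightarrow> (0 - 0) / z) F"
      using z by (intro tendsto_divide tendsto_diff tendsto_const Suc.prems(2)
          tendsto_constant_coeff[OF Suc.prems])
    \<comment> \<open>The coefficient bound, available only eventually, makes the series converge by
      comparison with a geometric one, so that splitting off the head and dividing termwise are
      legitimate.\<close>
    moreover have "\<forall>\<^sub>F s in F. ((\<Sum>n. a s n * z ^ n) - a s 0) / z = (\<Sum>n. a s (Suc n) * z ^ n)"
      using Suc.prems(1)
    proof eventually_elim
      case (elim s)
      have sg: "summable (\<lambda>n. B * norm z ^ n)" using z by (simp add: summable_mult)
      have "summable (\<lambda>n. a s n * z ^ n)"
        by (rule summable_comparison_test'[OF sg, of 0])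
          (use elim in \<open>simp add: norm_mult norm_power mult_right_mono\<close>)
      then have sm: "summable (\<lambda>n. a s (Suc n) * z ^ Suc n)"
        and eq: "(\<Sum>n. a s n * z ^ n) - a s 0 = (\<Sum>n. a s (Suc n) * z ^ Suc n)"
        using suminf_split_head[of "\<lambda>n. a s n * z ^ n"] summable_Suc_iff[of "\<lambda>n. a s n * z ^ n"]
        by simp_all
      show ?case
        unfolding eq suminf_divide[OF sm, symmetric] using z by (simp add: field_simps)
    qed
    ultimately show ?thesis
      by (simp add: tendsto_cong)
  qed
  moreover have "\<forall>\<^sub>F s in F. \<forall>n. norm (a s (Suc n)) \<le> B"
    using Suc.prems(1) by eventually_elim simp
  ultimately show ?case by (rule Suc.IH[rotated])
qed

text \<open>Two numbers in \<open>[0, 1]\<close> differ by at most 1, so the differences of the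
  coefficients are uniformly bounded and \<open>tendsto_coeff\<close> applies to them.\<close>

lemma gen_fun_tendsto_imp_coeff_tendsto:
  assumes q: "\<forall>\<^sub>F s in F. \<forall>n. 0 \<le> q s n \<and> q s n \<le> 1"
    and p: "\<And>n. 0 \<le> p n \<and> p n \<le> 1"
    and lim: "\<And>z. norm z < 1 \<Longrightarrow> ((\<lambda>s. gen_fun (q s) z) \<longlongrightarrow> gen_fun p z) F"
  shows "((\<lambda>s. q s k) \<longlongrightarrow> p k) F"
proof -
  have "((\<lambda>s. complex_of_real (q s k - p k)) \<longlongrightarrow> 0) F"
  proof (rule tendsto_coeff[where B = 1])
    show "\<forall>\<^sub>F s in F. \<forall>n. norm (complex_of_real (q s n - p n)) \<le> 1"
      using q
    proof eventually_elim
      case (elim s)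
      have "\<bar>q s n - p n\<bar> \<le> 1" for n
        using elim[rule_format, of n] p[of n] by linarith
      then show ?case by (simp only: norm_of_real) simp
    qed
  next
    fix z :: complex
    assume z: "norm z < 1"
    \<comment> \<open>Applied to both \<open>q s\<close> and \<open>p\<close>, this lets the
      difference of the generating functions be written as one power series.\<close>
    have sm: "summable (\<lambda>n. complex_of_real (u n) * z ^ n)" if "\<And>n. 0 \<le> u n \<and> u n \<le> 1" for u
    proof (rule summable_comparison_test'[of "\<lambda>n. norm z ^ n" 0])
      show "summable (\<lambda>n. norm z ^ n)" using z by simp
      show "norm (complex_of_real (u n) * z ^ n) \<le> norm z ^ n" for n
        using that by (simp add: norm_mult norm_power mult_left_le_one_le)
    qed
    have "((\<lambda>s. gen_fun (q s) z - gen_fun p z) \<longlongrightarrow> 0) F"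
      using lim[OF z] by (simp add: LIM_zero)
    moreover have "\<forall>\<^sub>F s in F. gen_fun (q s) z - gen_fun p z = (\<Sum>n. complex_of_real (q s n - p n) * z ^ n)"
      using q
    proof eventually_elim
      case (elim s)
      then show ?case
        unfolding gen_fun_def using suminf_diff[OF sm sm, of "q s" p] p
        by (simp add: algebra_simps)
    qed
    ultimately show "((\<lambda>s. \<Sum>n. complex_of_real (q s n - p n) * z ^ n) \<longlongrightarrow> 0) F"
      by (simp only: tendsto_cong)
  qed
  then have "((\<lambda>s. q s k - p k) \<longlongrightarrow> 0) F"
    using tendsto_of_real_iff[where 'a = complex, of _ 0] by force
  then show ?thesis by (rule LIM_zero_cancel)
qed

text \<open>The shortfall \<open>max 0 (p n - q s n)\<close> has the majorant \<open>p n\<close>,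
  independent of \<open>s\<close>, whereas the excess of \<open>q s\<close> over \<open>p\<close>
  has none in general. The excess is controlled through the total mass instead.\<close>

lemma scheffe_series:
  fixes q :: "'b \<Rightarrow> nat \<Rightarrow> real" and p :: "nat \<Rightarrow> real"
  assumes q0: "\<forall>\<^sub>F s in F. \<forall>n. 0 \<le> q s n"
    and qs: "\<forall>\<^sub>F s in F. summable (q s) \<and> suminf (q s) \<le> suminf p"
    and p0: "\<And>n. 0 \<le> p n" and ps: "summable p"
    and lim: "\<And>n. ((\<lambda>s. q s n) \<longlongrightarrow> p n) F"
  shows "((\<lambda>s. \<Sum>n. \<bar>q s n - p n\<bar>) \<longlongrightarrow> 0) F"
proof (cases "F = bot")
  case False
  have pt: "((\<lambda>s. max 0 (p n - q s n)) \<longlongrightarrow> 0) F" for n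
    using tendsto_max[OF tendsto_const tendsto_diff[OF tendsto_const lim], of 0 "p n" n] by simp
  \<comment> \<open>Tannery's theorem takes its bound in the product filter. It holds here for every
    \<open>n\<close> as soon as \<open>q s\<close> is nonnegative.\<close>
  have "\<forall>\<^sub>F (n, s) in at_top \<times>\<^sub>F F. norm (max 0 (p n - q s n)) \<le> p n"
    unfolding eventually_prod_filter
    by (rule exI[of _ "\<lambda>_. True"], rule exI[of _ "\<lambda>s. \<forall>n. 0 \<le> q s n"]) (use q0 p0 in auto)
  then have "((\<lambda>s. \<Sum>n. max 0 (p n - q s n)) \<longlongrightarrow> (\<Sum>n. 0)) F"
    by (intro tannerys_theorem[THEN conjunct2, THEN conjunct2, OF pt _ ps False])
  then have dom: "((\<lambda>s. 2 * (\<Sum>n. max 0 (p n - q s n))) \<longlongrightarrow> 0) F"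
    by (auto intro: tendsto_mult_right_zero)
  have "\<forall>\<^sub>F s in F. norm (\<Sum>n. \<bar>q s n - p n\<bar>) \<le> 2 * (\<Sum>n. max 0 (p n - q s n))"
    using q0 qs
  proof eventually_elim
    case (elim s)
    have sm: "summable (\<lambda>n. max 0 (p n - q s n))"
      by (rule summable_comparison_test'[OF ps, of 0]) (use elim p0 in auto)
    have sd: "summable (\<lambda>n. q s n - p n)"
      using elim ps by (intro summable_diff) auto
    have eq: "\<bar>q s n - p n\<bar> = 2 * max 0 (p n - q s n) + (q s n - p n)" for n
      by (simp add: max_def)
    \<comment> \<open>The bracket on the right is at most 0 by the mass assumption, which leaves
      twice the total shortfall.\<close>
    have "(\<Sum>n. \<bar>q s n - p n\<bar>) = 2 * (\<Sum>n. max 0 (p n - q s n)) + (suminf (q s) - suminf p)"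
      unfolding eq using sm sd elim ps
      by (simp add: suminf_add[symmetric] suminf_mult suminf_diff summable_mult)
    moreover have "summable (\<lambda>n. \<bar>q s n - p n\<bar>)"
      unfolding eq using sm sd by (intro summable_add summable_mult)
    then have "0 \<le> (\<Sum>n. \<bar>q s n - p n\<bar>)"
      by (rule suminf_nonneg) simp
    ultimately show ?case
      using elim by simp
  qed
  then show ?thesis by (rule Lim_null_comparison[OF _ dom])
qed simp

lemma count_prob_nonneg: "0 \<le> count_prob M A n"
  by (simp add: count_prob_def)

text \<open>As \<open>measure\<close> is \<open>0\<close> on a set that is not measurable, a non-measurable counting event
  may be replaced by the empty set.\<close>

lemma (in prob_space) count_prob_summable_le_1:
  "summable (count_prob M A) \<and> suminf (count_prob M A) \<le> 1"
proof -
  define E where "E n = {\<omega> \<in> space M. finite (A \<omega>) \<and> card (A \<omega>) = n}" for n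
  define E' where "E' n = (if E n \<in> sets M then E n else {})" for n
  have eq: "count_prob M A = (\<lambda>n. prob (E' n))"
    by (auto simp: count_prob_def E_def[symmetric] E'_def measure_notin_sets)
  have "disjoint_family E'"
    by (auto simp: disjoint_family_on_def E'_def E_def)
  moreover have "range E' \<subseteq> events" by (auto simp: E'_def)
  \<comment> \<open>The union can have probability below 1: outcomes with infinite
    \<open>A \<omega>\<close> belong to no \<open>E n\<close>.\<close>
  ultimately have "(\<lambda>n. prob (E' n)) sums prob (\<Union>n. E' n)"
    by (intro finite_measure_UNION)
  then show ?thesis
    unfolding eq by (metis prob_le_1 sums_summable sums_unique)
qed

lemma (in prob_space) count_prob_le_1: "count_prob M A n \<le> 1"
  by (simp add: count_prob_def)

lemma poisson_prob_sums: "poisson_prob r sums 1"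
proof -
  have "poisson_prob r = (\<lambda>n. exp (- r) * (r ^ n /\<^sub>R fact n))"
    by (rule ext) (simp add: poisson_prob_def divide_inverse)
  then show ?thesis
    using sums_mult[OF exp_converges[of r], of "exp (- r)"] by (simp add: exp_add[symmetric])
qed

lemma poisson_prob_nonneg: "0 \<le> r \<Longrightarrow> 0 \<le> poisson_prob r n"
  by (simp add: poisson_prob_def)

lemma poisson_prob_le_1:
  assumes "0 \<le> r" shows "poisson_prob r n \<le> 1"
  using sum_le_suminf[of "poisson_prob r" "{n}"] poisson_prob_sums[of r] poisson_prob_nonneg[OF assms]
  by (auto simp: sums_iff)

lemma gen_fun_poisson_prob: "gen_fun (poisson_prob r) z = exp (of_real r * (z - 1))"
proof -
  have "(\<lambda>n. of_real (poisson_prob r n) * z ^ n) sums (exp (- of_real r) * exp (of_real r * z))"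
  proof -
    have "of_real (poisson_prob r n) * z ^ n
        = exp (- of_real r) * ((of_real r * z) ^ n /\<^sub>R fact n)" for n
      by (simp add: poisson_prob_def scaleR_conv_of_real power_mult_distrib exp_of_real[symmetric]
          divide_inverse mult_ac)
    then show ?thesis
      using sums_mult[OF exp_converges[of "of_real r * z"], of "exp (- of_real r)"] by simp
  qed
  then show ?thesis
    by (simp add: gen_fun_def sums_iff exp_add[symmetric] algebra_simps)
qed

text \<open>Common core of both halves of the theorem, with \<open>A\<close> standing for
  \<open>arrivals\<close> or \<open>kept_arrivals\<close>. The rate 0 is included because \<gamma>
  may be 0.\<close>

lemma count_prob_tendsto_poisson:
  assumes M: "\<forall>\<^sub>F s in F. prob_space (M s)" and r: "0 \<le> r"
    and lim: "\<And>z. norm z \<le> 1 \<Longrightarrow>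
      ((\<lambda>s. gen_fun (count_prob (M s) (A s)) z) \<longlongrightarrow> exp (of_real r * (z - 1))) F"
  shows "((\<lambda>s. \<Sum>n. \<bar>count_prob (M s) (A s) n - poisson_prob r n\<bar>) \<longlongrightarrow> 0) F"
proof (rule scheffe_series)
  show "\<forall>\<^sub>F s in F. \<forall>n. 0 \<le> count_prob (M s) (A s) n"
    by (simp add: count_prob_nonneg)
  show "\<forall>\<^sub>F s in F. summable (count_prob (M s) (A s)) \<and>
      suminf (count_prob (M s) (A s)) \<le> suminf (poisson_prob r)"
    using M
    by eventually_elim
      (use poisson_prob_sums[of r] prob_space.count_prob_summable_le_1 in \<open>auto simp: sums_iff\<close>)
  show "summable (poisson_prob r)" using poisson_prob_sums by (rule sums_summable)
  show "0 \<le> poisson_prob r n" for n using r by (rule poisson_prob_nonneg)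
  show "((\<lambda>s. count_prob (M s) (A s) n) \<longlongrightarrow> poisson_prob r n) F" for n
  proof (rule gen_fun_tendsto_imp_coeff_tendsto)
    show "\<forall>\<^sub>F s in F. \<forall>n. 0 \<le> count_prob (M s) (A s) n \<and> count_prob (M s) (A s) n \<le> 1"
      using M by eventually_elim (simp add: count_prob_nonneg prob_space.count_prob_le_1)
  qed (use r lim in \<open>auto simp: gen_fun_poisson_prob poisson_prob_nonneg poisson_prob_le_1\<close>)
qed

theorem theorem2p5:
  fixes f :: "real \<Rightarrow> real" and lam t T \<gamma> :: real
    and M :: "real \<Rightarrow> 'a measure"
    and \<xi> :: "real \<Rightarrow> int \<Rightarrow> 'a \<Rightarrow> real"
    and kept :: "real \<Rightarrow> int \<Rightarrow> 'a \<Rightarrow> bool"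
    and q q\<gamma> :: "real \<Rightarrow> nat \<Rightarrow> real"
  defines "q \<equiv> \<lambda>\<sigma>. count_prob (M \<sigma>) (arrivals lam (\<xi> \<sigma>) t T)"
    and "q\<gamma> \<equiv> \<lambda>\<sigma>. count_prob (M \<sigma>) (kept_arrivals lam (\<xi> \<sigma>) (kept \<sigma>) t T)"
  assumes "psra_density f"
    and "lam > 0" and "T > 0" and "\<gamma> \<in> {0..1}"
    and "\<And>\<sigma>. \<sigma> > 0 \<Longrightarrow> psra_delays (M \<sigma>) f \<sigma> (\<xi> \<sigma>)"
  shows
    "((\<forall>z::complex. norm z \<le> 1 \<longrightarrow>
         ((\<lambda>\<sigma>. gen_fun (q \<sigma>) z) \<longlongrightarrow> exp (of_real (lam * T) * (z - 1))) at_top) \<longrightarrow>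
      ((\<lambda>\<sigma>. \<Sum>n. \<bar>q \<sigma> n - poisson_prob (lam * T) n\<bar>) \<longlongrightarrow> 0) at_top)
     \<and>
     ((\<forall>\<sigma>>0. psra_deletions (M \<sigma>) f \<sigma> (\<xi> \<sigma>) \<gamma> (kept \<sigma>)) \<longrightarrow>
      (\<forall>z::complex. norm z \<le> 1 \<longrightarrow>
         ((\<lambda>\<sigma>. gen_fun (q\<gamma> \<sigma>) z) \<longlongrightarrow> exp (of_real (\<gamma> * lam * T) * (z - 1))) at_top) \<longrightarrow>
      ((\<lambda>\<sigma>. \<Sum>n. \<bar>q\<gamma> \<sigma> n - poisson_prob (\<gamma> * lam * T) n\<bar>) \<longlongrightarrow> 0) at_top)"
proof -
  \<comment> \<open>The delay assumptions are made for \<sigma> > 0 only, which holds eventually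
    along \<open>at_top\<close>.\<close>
  have M: "\<forall>\<^sub>F \<sigma> in at_top. prob_space (M \<sigma>)"
    using eventually_gt_at_top[of 0]
    by eventually_elim (use assms(7) psra_delays_def in blast)
  have r: "0 \<le> lam * T" "0 \<le> \<gamma> * lam * T"
    using assms by auto
  show ?thesis
    unfolding q_def q\<gamma>_def
  proof (intro conjI impI, goal_cases)
    case 1
    show ?case
      by (rule count_prob_tendsto_poisson[OF M r(1)]) (rule 1[rule_format])
  next
    case 2
    show ?case
      by (rule count_prob_tendsto_poisson[OF M r(2)]) (rule 2(2)[rule_format])
  qed
qed

end
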